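(* Let $f:\mathbb{N}\to\mathbb{N}$ and let $m,k,n\ge 0$ be nonnegative integers with $k,n$ not both zero. Then $$\binom{mk}{n}_{f}\equiv 0\pmod{\frac{k}{\gcd(k,n)}}.$$
   Context: $\mathbb{N}=\{0,1,2,\dots\}$. For a function $f:\mathbb{N}\to\mathbb{N}$ and integers $k,n\ge 0$, the extended binomial coefficient $\binom{k}{n}_{f}$ is the coefficient of $x^n$ in the formal power series $\bigl(\sum_{s\in\mathbb{N}} f(s)x^s\bigr)^k$. A congruence modulo $0$ means equality. *)

theory Defs
  imports "HOL-Computational_Algebra.Formal_Power_Series" "HOL-Number_Theory.Cong"
begin

definition ext_binomial :: "(nat \<Rightarrow> nat) \<Rightarrow> nat \<Rightarrow> nat \<Rightarrow> nat" where
  "ext_binomial f k n = fps_nth (Abs_fps f ^ k) n"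

end

theory Submission imports Defs begin

text \<open>Differentiating the \<open>N\<close>-th power of a series \<open>F\<close> gives \<open>N F\<^sup>N\<^sup>-\<^sup>1 F'\<close>, so \<open>N\<close> divides \<open>n\<close> times the
  \<open>n\<close>-th coefficient of the power. For \<open>N = m k\<close>, cancelling \<open>gcd k n\<close> and then the factor
  \<open>n / gcd k n\<close>, which is coprime to \<open>k / gcd k n\<close>, gives the claim.\<close>

lemma dvd_mult_ext_binomial: "N dvd n * ext_binomial f N n"
proof (cases n)
  case (Suc i)
  let ?F = "Abs_fps f"
  \<comment> \<open>Differentiation shifts coefficients down by one, hence index \<open>i\<close>
    with \<open>n = Suc i\<close>.\<close>
  have "n * ext_binomial f N n = fps_nth (fps_deriv (?F ^ N)) i"
    by (simp add: ext_binomial_def Suc)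
  \<comment> \<open>For \<open>N = 0\<close> the truncated exponent \<open>N - 1\<close> is
    harmless, since the factor \<open>N\<close> vanishes.\<close>
  also have "\<dots> = fps_nth (fps_const N * (fps_deriv ?F * ?F ^ (N - 1))) i"
    by (simp only: fps_deriv_power mult.assoc of_nat_id)
  also have "\<dots> = N * fps_nth (fps_deriv ?F * ?F ^ (N - 1)) i"
    by (rule fps_mult_left_const_nth)
  finally show ?thesis by simp
qed simp

theorem theorem19:
  fixes f :: "nat \<Rightarrow> nat" and m k n :: nat
  assumes "\<not> (k = 0 \<and> n = 0)"
  shows "[ext_binomial f (m * k) n = 0] (mod (k div gcd k n))"
proof -
  define g where "g = gcd k n"
  have "g \<noteq> 0" using assms by (auto simp: g_def)
  have "k dvd n * ext_binomial f (m * k) n"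
    using dvd_mult_ext_binomial[of "m * k"] dvd_mult_right by blast
  then have "g * (k div g) dvd g * (n div g * ext_binomial f (m * k) n)"
    by (simp add: g_def mult.assoc[symmetric])
  then have "k div g dvd n div g * ext_binomial f (m * k) n"
    using \<open>g \<noteq> 0\<close> by simp
  \<comment> \<open>This includes \<open>k = 0\<close>: then \<open>g = n\<close>, so the modulus is
    0 and its cofactor \<open>n div g\<close> is 1, and divisibility by 0 is the required
    equality.\<close>
  moreover have "coprime (k div g) (n div g)"
    unfolding g_def using assms by (intro div_gcd_coprime) auto
  ultimately show ?thesis
    by (simp add: cong_0_iff coprime_dvd_mult_right_iff g_def)
qed

end
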